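(* Let $\mathsf H_{20}$ be the 20-vertex, 12-hyperedge hypergraph defined in the context. Set $$C=\frac{49-5\sqrt{69}}{26},\quad s=\sqrt C,\quad N=1+C,\quad r=\sqrt N,$$ $$\eta=\frac{5+12\mathrm i}{13},\qquad \zeta=\frac{14+6\sqrt{69}}{65}+\mathrm i\,\frac{4\sqrt{69}-21}{65},$$ $$(\mu_0,\ldots,\mu_7)=(-1,\eta,1,-\eta,-1,\eta,1,-\eta),$$ $$(\tau_0,\ldots,\tau_7)=(1,\zeta,-\mathrm i,-\mathrm i\zeta,-1,-\zeta,\mathrm i,\mathrm i\zeta).$$ Assign to the vertices of $\mathsf H_{20}$ the following vectors in $\mathbb C^3$ (denoted by the same symbols as the vertices): $$a_1=(s,1,0),\quad a_2=(s,-1,0),\quad b_1=(s,\eta,0),\quad b_2=(s,-\eta,0),$$ $$v_j=(1,\,s\mu_j,\,r\tau_j),\qquad j=0,\ldots,7,$$ and, for $j=0,\ldots,7$ with indices modulo $8$, $v_{j,j+1}=\overline{v_j\times v_{j+1}}$ (complex conjugate of the bilinear cross product), i.e. $$v_{j,j+1}=\bigl(sr(\bar\mu_j\bar\tau_{j+1}-\bar\tau_j\bar\mu_{j+1}),\ r(\bar\tau_j-\bar\tau_{j+1}),\ s(\bar\mu_{j+1}-\bar\mu_j)\bigr).$$ Then this assignment is a faithful orthogonal representation of $\mathsf H_{20}$ in $\mathbb C^3$.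
   Context: Inner product: $\langle x,y\rangle=\sum_{k}\overline{x_k}\,y_k$. Faithful orthogonal representation: let $\mathsf H=(V,\mathcal E)$ be a three-uniform hypergraph, $\mathbb F\in\{\mathbb R,\mathbb C\}$ and $d\ge 3$. A faithful orthogonal representation of $\mathsf H$ in $\mathbb F^d$ assigns to every $v\in V$ a nonzero vector $x_v\in\mathbb F^d$ such that (1) distinct vertices determine distinct rays (one-dimensional subspaces), and (2) for distinct $u,v\in V$, $\langle x_u,x_v\rangle=0$ if and only if $u$ and $v$ belong to a common hyperedge. The hypergraph $\mathsf H_{20}$: it has 20 vertices, namely $v_0,\ldots,v_7$ (midpoints), $v_{01},v_{12},v_{23},v_{34},v_{45},v_{56},v_{67},v_{70}$ (corners; also written $v_{j,j+1}$ with indices modulo $8$), and $a_1,a_2,b_1,b_2$. It has 12 hyperedges: $E_j=\{v_{j-1,j},\,v_j,\,v_{j,j+1}\}$ for $j=0,\ldots,7$ (indices modulo $8$), and $D_0=\{v_0,a_1,v_4\}$, $D_2=\{v_2,a_2,v_6\}$, $D_1=\{v_1,b_2,v_5\}$, $D_3=\{v_3,b_1,v_7\}$. *)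

theory Defs
  imports "HOL-Analysis.Analysis"
begin

definition three_uniform_hypergraph :: "'v set \<Rightarrow> 'v set set \<Rightarrow> bool" where
  "three_uniform_hypergraph V E \<longleftrightarrow> (\<forall>e\<in>E. e \<subseteq> V \<and> card e = 3)"

(* The Hermitian product, conjugate-linear in the first argument. The library's inner product on
   complex^'n is only the real part of it. *)
definition hinner :: "complex ^ 'n \<Rightarrow> complex ^ 'n \<Rightarrow> complex" where
  "hinner x y = (\<Sum>k\<in>UNIV. cnj (x $ k) * y $ k)"

(* vec.span is the span over the complex scalars, so vec.span {x v} is the ray of x v;
   the span of the class real_vector would use real scalars only. *)
definition faithful_orthogonal_representation ::
    "'v set \<Rightarrow> 'v set set \<Rightarrow> ('v \<Rightarrow> complex ^ 'n) \<Rightarrow> bool" where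
  "faithful_orthogonal_representation V E x \<longleftrightarrow>
     three_uniform_hypergraph V E \<and> CARD('n) \<ge> 3 \<and>
     (\<forall>v\<in>V. x v \<noteq> 0) \<and>
     (\<forall>u\<in>V. \<forall>v\<in>V. u \<noteq> v \<longrightarrow> vec.span {x u} \<noteq> vec.span {x v}) \<and>
     (\<forall>u\<in>V. \<forall>v\<in>V. u \<noteq> v \<longrightarrow>
        (hinner (x u) (x v) = 0 \<longleftrightarrow> (\<exists>e\<in>E. u \<in> e \<and> v \<in> e)))"

(* Mid j is the midpoint v_j and Corner j the corner v_{j,j+1}, with j + 1 taken modulo 8.
   Only the indices j < 8 occur in the vertex set below. *)
datatype vertex = Mid nat | Corner nat | A1 | A2 | B1 | B2

definition H20_vertices :: "vertex set" where
  "H20_vertices = Mid ` {..<8} \<union> Corner ` {..<8} \<union> {A1, A2, B1, B2}"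

(* (j + 7) mod 8 is j - 1 modulo 8 (nat subtraction would truncate at j = 0). *)
definition H20_edges :: "vertex set set" where
  "H20_edges =
     (\<lambda>j. {Corner ((j + 7) mod 8), Mid j, Corner j}) ` {..<8} \<union>
     {{Mid 0, A1, Mid 4}, {Mid 2, A2, Mid 6}, {Mid 1, B2, Mid 5}, {Mid 3, B1, Mid 7}}"

lemma lessThan_8: "{..<8::nat} = {0, 1, 2, 3, 4, 5, 6, 7}"
  by auto

lemma card_H20_vertices: "card H20_vertices = 20"
  by (simp add: H20_vertices_def lessThan_8)

lemma card_H20_edges: "card H20_edges = 12"
  by (simp add: H20_edges_def lessThan_8 card_insert_if set_eq_subset)

lemma three_uniform_H20: "three_uniform_hypergraph H20_vertices H20_edges"
  by (simp add: three_uniform_hypergraph_def H20_vertices_def H20_edges_def lessThan_8)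

(* The bilinear cross product; the library's cross3 is for real vectors only. *)
definition ccross :: "complex ^ 3 \<Rightarrow> complex ^ 3 \<Rightarrow> complex ^ 3" where
  "ccross x y =
     vector [x $ 2 * y $ 3 - x $ 3 * y $ 2,
             x $ 3 * y $ 1 - x $ 1 * y $ 3,
             x $ 1 * y $ 2 - x $ 2 * y $ 1]"

definition cnj_vec :: "complex ^ 'n \<Rightarrow> complex ^ 'n" where
  "cnj_vec x = (\<chi> k. cnj (x $ k))"

end

theory Submission
  imports Defs
begin

text \<open>Up to the nonzero factors \<open>s\<close> and \<open>r\<close>, all Hermitian products of the vectors lie in the field
  generated over the rationals by \<open>\<i>\<close> and \<open>sqrt 69\<close>, where vanishing is decided by comparing four
  rational coordinates; products of two cross products are reduced to those of the midpoint
  vectors by Lagrange's identity. Orthogonality then determines the hypergraph, and the rest is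
  combinatorial: the hypergraph has no triangles, so nonadjacent vertices have different
  neighbourhoods, and hence their vectors span different rays.\<close>

section \<open>Arithmetic in the field generated by sqrt 69 and the imaginary unit\<close>

lemma sqrt_69_irrational: "sqrt 69 \<notin> \<rat>"
proof
  assume "sqrt 69 \<in> \<rat>"
  then obtain m n :: nat where n: "n \<noteq> 0" and mn: "\<bar>sqrt 69\<bar> = real m / real n"
    and cop: "coprime m n"
    by (rule Rats_abs_nat_div_natE)
  have "69 = (real m / real n)\<^sup>2"
    by (simp flip: mn)
  then have "real (m\<^sup>2) = real (69 * n\<^sup>2)"
    using n by (simp add: power_divide field_simps)
  then have "m\<^sup>2 = 69 * n\<^sup>2"
    by (simp only: of_nat_eq_iff)
  then have "n\<^sup>2 dvd m\<^sup>2"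
    by simp
  with cop n have "n = 1"
    by (metis coprime_common_divisor_nat coprime_power_right_iff coprime_power_left_iff
        dvd_refl nat_power_eq_Suc_0_iff zero_neq_numeral One_nat_def)
  with \<open>m\<^sup>2 = 69 * n\<^sup>2\<close> have m2: "m * m = 69"
    by (simp add: power2_eq_square)
  \<comment> \<open>69 lies strictly between the squares of 8 and 9.\<close>
  have "m \<le> 8 \<or> 9 \<le> m"
    by linarith
  then show False
    using mult_le_mono[of m 8 m 8] mult_le_mono[of 9 m 9 m] m2 by auto
qed

text \<open>Coordinates in the basis 1, \<open>sqrt 69\<close>, \<open>\<i>\<close>,
  \<open>\<i> * sqrt 69\<close> over the rationals, so that the simplifier can evaluate field
  expressions and test them for zero.\<close>

definition quad :: "rat \<Rightarrow> rat \<Rightarrow> rat \<Rightarrow> rat \<Rightarrow> complex" where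
  "quad a b c d =
     Complex (of_rat a + of_rat b * sqrt 69) (of_rat c + of_rat d * sqrt 69)"

lemma rat_combination_sqrt_69_eq_0_iff:
  "of_rat a + of_rat b * sqrt 69 = 0 \<longleftrightarrow> a = 0 \<and> b = 0"
proof
  assume eq: "of_rat a + of_rat b * sqrt 69 = 0"
  have "b = 0"
  proof (rule ccontr)
    assume "b \<noteq> 0"
    with eq have "sqrt 69 = of_rat (- a / b)"
      by (simp add: of_rat_divide of_rat_minus field_simps)
    then show False
      using sqrt_69_irrational by auto
  qed
  with eq show "a = 0 \<and> b = 0"
    by simp
qed simp

lemma quad_eq_0_iff: "quad a b c d = 0 \<longleftrightarrow> a = 0 \<and> b = 0 \<and> c = 0 \<and> d = 0"
  by (auto simp: quad_def complex_eq_iff rat_combination_sqrt_69_eq_0_iff)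

lemma quad_add: "quad a b c d + quad a' b' c' d' = quad (a + a') (b + b') (c + c') (d + d')"
  by (simp add: quad_def complex_eq_iff of_rat_add algebra_simps)

lemma quad_minus: "- quad a b c d = quad (- a) (- b) (- c) (- d)"
  by (simp add: quad_def complex_eq_iff of_rat_minus)

lemma quad_diff: "quad a b c d - quad a' b' c' d' = quad (a - a') (b - b') (c - c') (d - d')"
  by (simp add: quad_def complex_eq_iff of_rat_diff algebra_simps)

lemma quad_cnj: "cnj (quad a b c d) = quad a b (- c) (- d)"
  by (simp add: quad_def complex_eq_iff of_rat_minus)

lemma quad_mult:
  "quad a b c d * quad a' b' c' d' =
     quad (a * a' + 69 * b * b' - c * c' - 69 * d * d') (a * b' + b * a' - c * d' - d * c')
          (a * c' + 69 * b * d' + c * a' + 69 * d * b') (a * d' + b * c' + c * b' + d * a')"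
proof -
  \<comment> \<open>\<open>algebra_simps\<close> associates products to the right, so the square of
    \<open>sqrt 69\<close> must also be recognised in front of a further factor.\<close>
  have "sqrt 69 * (sqrt 69 * z) = 69 * z" for z :: real
    by (simp flip: mult.assoc)
  then show ?thesis
    by (simp add: quad_def complex_eq_iff of_rat_add of_rat_diff of_rat_mult algebra_simps)
qed

lemmas quad_arith = quad_eq_0_iff quad_add quad_minus quad_diff quad_cnj quad_mult

section \<open>Hermitian products and cross products\<close>

lemma hinner_commute: "hinner y x = cnj (hinner x y)"
  by (simp add: hinner_def mult.commute)

lemma hinner_scale: "hinner (c *s x) y = cnj c * hinner x y"
  by (simp add: hinner_def sum_distrib_left mult.assoc)

lemma hinner_self_eq_0_iff: "hinner x x = 0 \<longleftrightarrow> x = 0"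
proof -
  have "hinner x x = complex_of_real (\<Sum>k\<in>UNIV. (cmod (x $ k))\<^sup>2)"
    unfolding hinner_def of_real_sum
    by (intro sum.cong refl) (metis complex_norm_square mult.commute)
  then show ?thesis
    by (simp only: of_real_eq_0_iff) (simp add: sum_nonneg_eq_0_iff vec_eq_iff)
qed

lemma hinner_vector_3:
  "hinner (vector [a, b, c] :: complex ^ 3) (vector [a', b', c']) =
     cnj a * a' + cnj b * b' + cnj c * c'"
  by (simp add: hinner_def sum_3 vector_3)

text \<open>The conjugation in \<open>cnj_vec\<close> cancels the one in \<open>hinner\<close>,
  which leaves the determinant with rows \<open>x\<close>, \<open>y\<close>, \<open>z\<close>. It
  vanishes when \<open>z\<close> is \<open>x\<close> or \<open>y\<close>, so each corner is
  orthogonal to the midpoints that define it.\<close>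

lemma hinner_cnj_ccross:
  "hinner (cnj_vec (ccross x y)) z =
     x $ 1 * (y $ 2 * z $ 3 - y $ 3 * z $ 2) + x $ 2 * (y $ 3 * z $ 1 - y $ 1 * z $ 3) +
     x $ 3 * (y $ 1 * z $ 2 - y $ 2 * z $ 1)"
  by (simp add: hinner_def cnj_vec_def ccross_def sum_3 vector_3 algebra_simps)

text \<open>Lagrange's identity for four vectors (Binet-Cauchy). The outer conjugations swap the
  arguments of the products on the right.\<close>

lemma hinner_cnj_ccross_cnj_ccross:
  "hinner (cnj_vec (ccross x y)) (cnj_vec (ccross z w)) =
     hinner z x * hinner w y - hinner w x * hinner z y"
  by (simp add: hinner_def cnj_vec_def ccross_def sum_3 vector_3 algebra_simps)

lemma span_singleton_eq_imp_hinner_eq_0_iff: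
  assumes "vec.span {x} = vec.span {y}"
  shows "hinner x z = 0 \<longleftrightarrow> hinner y z = 0"
proof -
  have "x \<in> vec.span {y}" "y \<in> vec.span {x}"
    using assms vec.span_base[of x "{x}"] vec.span_base[of y "{y}"] by auto
  then obtain c d where "x = c *s y" "y = d *s x"
    unfolding vec.span_singleton by blast
  then show ?thesis
    by (metis hinner_scale mult_zero_right)
qed

section \<open>The hypergraph\<close>

text \<open>Equal arguments are allowed, so every vertex on an edge is adjacent to itself and
  nonadjacent vertices of the hypergraph are distinct.\<close>

definition H20_adjacent :: "vertex \<Rightarrow> vertex \<Rightarrow> bool" where
  "H20_adjacent u v \<longleftrightarrow> (\<exists>e\<in>H20_edges. u \<in> e \<and> v \<in> e)"

lemma H20_adjacent_commute: "H20_adjacent u v \<longleftrightarrow> H20_adjacent v u"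
  by (auto simp: H20_adjacent_def)

lemmas H20_adjacent_simps = H20_adjacent_def H20_edges_def lessThan_8

lemma all_less_8:
  "(\<forall>j<8. P j) \<longleftrightarrow> P 0 \<and> P 1 \<and> P 2 \<and> P 3 \<and> P 4 \<and> P 5 \<and> P 6 \<and> P (7 :: nat)"
  using lessThan_8 by (metis (no_types, lifting) insert_iff empty_iff lessThan_iff)

lemma H20_vertex_cases [consumes 1, case_names Mid Corner Apex]:
  assumes "u \<in> H20_vertices"
  obtains j where "u = Mid j" "j < 8" | j where "u = Corner j" "j < 8" | "u \<in> {A1, A2, B1, B2}"
  using assms unfolding H20_vertices_def by blast

lemma H20_edge_covering: "\<forall>u\<in>H20_vertices. \<exists>e\<in>H20_edges. u \<in> e"
  by (simp add: H20_vertices_def H20_edges_def lessThan_8)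

lemma H20_triangle_free:
  "\<forall>e\<in>H20_edges. \<forall>w\<in>e. \<forall>w'\<in>e. \<forall>v\<in>H20_vertices.
     v \<notin> e \<longrightarrow> H20_adjacent v w \<longrightarrow> H20_adjacent v w' \<longrightarrow> w = w'"
  by code_simp

text \<open>An edge through \<open>u\<close> misses \<open>v\<close>, so by triangle-freeness
  \<open>v\<close> is adjacent to at most one of the two other vertices on it; the remaining one
  serves as \<open>w\<close>.\<close>

lemma H20_distinguishing_neighbour:
  assumes "u \<in> H20_vertices" "v \<in> H20_vertices" "\<not> H20_adjacent u v"
  obtains w where "w \<in> H20_vertices" "w \<noteq> u" "H20_adjacent u w" "\<not> H20_adjacent v w"
proof -
  obtain e where e: "e \<in> H20_edges" "u \<in> e"
    using H20_edge_covering assms by blast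
  have "card e = 3" and sub: "e \<subseteq> H20_vertices"
    using three_uniform_H20 e by (auto simp: three_uniform_hypergraph_def)
  with \<open>u \<in> e\<close> have "card (e - {u}) = 2"
    by simp
  then obtain w w' where w: "e - {u} = {w, w'}" "w \<noteq> w'"
    by (auto simp: card_2_iff)
  have "v \<notin> e"
    using assms e by (auto simp: H20_adjacent_def)
  then have "\<not> H20_adjacent v w \<or> \<not> H20_adjacent v w'"
    using H20_triangle_free e w assms by blast
  moreover have "H20_adjacent u w" "H20_adjacent u w'"
    using e w by (auto simp: H20_adjacent_def)
  ultimately show ?thesis
    using that w sub by blast
qed

lemma H20_nonadjacent_vertex: "\<forall>u\<in>H20_vertices. \<exists>v\<in>H20_vertices. u \<noteq> v \<and> \<not> H20_adjacent u v"
  by code_simp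

text \<open>The orthogonality condition alone forces nonzero vectors and distinct rays: the zero vector
  is orthogonal to everything, while vectors on a common ray are orthogonal to the same vectors.\<close>

lemma faithful_orthogonal_representation_H20I:
  fixes x :: "vertex \<Rightarrow> complex ^ 'n"
  assumes "CARD('n) \<ge> 3"
    and orth: "\<And>u v. u \<in> H20_vertices \<Longrightarrow> v \<in> H20_vertices \<Longrightarrow> u \<noteq> v \<Longrightarrow>
      hinner (x u) (x v) = 0 \<longleftrightarrow> H20_adjacent u v"
  shows "faithful_orthogonal_representation H20_vertices H20_edges x"
proof -
  have nonzero: "x u \<noteq> 0" if "u \<in> H20_vertices" for u
  proof
    assume "x u = 0"
    then have "hinner (x u) z = 0" for z
      by (simp add: hinner_def)
    with orth that H20_nonadjacent_vertex show False
      by blast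
  qed
  have "vec.span {x u} \<noteq> vec.span {x v}"
    if uv: "u \<in> H20_vertices" "v \<in> H20_vertices" "u \<noteq> v" for u v
  proof
    assume "vec.span {x u} = vec.span {x v}"
    note same = span_singleton_eq_imp_hinner_eq_0_iff[OF this]
    \<comment> \<open>Otherwise \<open>x u\<close> is orthogonal to \<open>x v\<close>, and on a
      common ray \<open>x v\<close> would be orthogonal to itself.\<close>
    have "\<not> H20_adjacent u v"
      using orth same[of "x v"] hinner_self_eq_0_iff nonzero uv by blast
    moreover from this obtain w where
      "w \<in> H20_vertices" "w \<noteq> u" "H20_adjacent u w" "\<not> H20_adjacent v w"
      using H20_distinguishing_neighbour uv by blast
    \<comment> \<open>\<open>x w\<close> is orthogonal to \<open>x u\<close>, hence to
      \<open>x v\<close>, although \<open>v\<close> and \<open>w\<close> are nonadjacent;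
      \<open>w\<close> differs from \<open>v\<close> because only \<open>w\<close> is adjacent to
      \<open>u\<close>.\<close>
    ultimately show False
      using orth same[of "x w"] uv by metis
  qed
  then show ?thesis
    using assms nonzero three_uniform_H20
    by (simp add: faithful_orthogonal_representation_def H20_adjacent_def)
qed

section \<open>The representation\<close>

locale H20_vectors =
  fixes C s N r :: real
    and \<eta> \<zeta> :: complex
    and \<mu> \<tau> :: "nat \<Rightarrow> complex"
    and x :: "vertex \<Rightarrow> complex ^ 3"
  assumes C_eq: "C = (49 - 5 * sqrt 69) / 26"
    and s_eq: "s = sqrt C"
    and N_eq: "N = 1 + C"
    and r_eq: "r = sqrt N"
    and eta_eq: "\<eta> = (5 + 12 * \<i>) / 13"
    and zeta_eq: "\<zeta> = complex_of_real ((14 + 6 * sqrt 69) / 65)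
              + \<i> * complex_of_real ((4 * sqrt 69 - 21) / 65)"
    and mu_list: "map \<mu> [0..<8] = [-1, \<eta>, 1, -\<eta>, -1, \<eta>, 1, -\<eta>]"
    and tau_list: "map \<tau> [0..<8] = [1, \<zeta>, -\<i>, -\<i> * \<zeta>, -1, -\<zeta>, \<i>, \<i> * \<zeta>]"
    and A1: "x A1 = vector [of_real s, 1, 0]"
    and A2: "x A2 = vector [of_real s, -1, 0]"
    and B1: "x B1 = vector [of_real s, \<eta>, 0]"
    and B2: "x B2 = vector [of_real s, -\<eta>, 0]"
    and Mid: "\<And>j. j < 8 \<Longrightarrow> x (Mid j) = vector [1, of_real s * \<mu> j, of_real r * \<tau> j]"
    and Corner: "\<And>j. j < 8 \<Longrightarrow>
      x (Corner j) = cnj_vec (ccross (x (Mid j)) (x (Mid ((j + 1) mod 8))))"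
begin

section \<open>The constants in coordinates\<close>

lemma C_bounds: "0 < C" "C < 1"
proof -
  \<comment> \<open>The bounds 23/5 and 49/5 are the values of \<open>sqrt 69\<close> at which
    \<open>C\<close> would be 1 and 0.\<close>
  have "23 / 5 < sqrt 69"
    by (rule real_less_rsqrt) (simp add: power2_eq_square)
  moreover have "sqrt 69 < 49 / 5"
    by (rule real_less_lsqrt) (simp_all add: power2_eq_square)
  ultimately show "0 < C" "C < 1"
    by (auto simp: C_eq)
qed

lemma s_squared: "of_real s * of_real s = complex_of_real C"
  and r_squared: "of_real r * of_real r = complex_of_real N"
  and s_nonzero: "s \<noteq> 0"
  and r_nonzero: "r \<noteq> 0"
  using C_bounds by (auto simp: s_eq r_eq N_eq simp flip: of_real_mult)

text \<open>Used as rewrite rules from left to right. The rule \<open>quad_1\<close> does not loop: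
  its left side is the complex 1, while the coordinates on its right are rational.\<close>

lemma quad_1: "1 = quad 1 0 0 0"
  and quad_i: "\<i> = quad 0 0 1 0"
  and quad_C: "of_real C = quad (49/26) (-5/26) 0 0"
  and quad_N: "of_real N = quad (75/26) (-5/26) 0 0"
  and quad_eta: "\<eta> = quad (5/13) 0 (12/13) 0"
  and quad_zeta: "\<zeta> = quad (14/65) (6/65) (-21/65) (4/65)"
  by (simp_all add: quad_def complex_eq_iff C_eq N_eq eta_eq zeta_eq of_rat_divide of_rat_minus
      field_simps)

lemma mu:
  "\<mu> 0 = -1" "\<mu> 1 = \<eta>" "\<mu> 2 = 1" "\<mu> 3 = -\<eta>"
  "\<mu> 4 = -1" "\<mu> 5 = \<eta>" "\<mu> 6 = 1" "\<mu> 7 = -\<eta>"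
  using mu_list by (simp_all add: upt_rec numeral_eq_Suc)

lemma tau:
  "\<tau> 0 = 1" "\<tau> 1 = \<zeta>" "\<tau> 2 = -\<i>" "\<tau> 3 = -\<i> * \<zeta>"
  "\<tau> 4 = -1" "\<tau> 5 = -\<zeta>" "\<tau> 6 = \<i>" "\<tau> 7 = \<i> * \<zeta>"
  using tau_list by (simp_all add: upt_rec numeral_eq_Suc)

lemmas quad_simps = mu tau quad_1 quad_i quad_C quad_N quad_eta quad_zeta quad_arith

section \<open>Orthogonality for each pair of vertex kinds\<close>

lemma hinner_Mid_Mid:
  assumes "j < 8" "k < 8"
  shows "hinner (x (Mid j)) (x (Mid k)) =
    1 + of_real C * (cnj (\<mu> j) * \<mu> k) + of_real N * (cnj (\<tau> j) * \<tau> k)"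
  using assms
  by (simp add: Mid hinner_vector_3 mult_ac flip: s_squared r_squared)

lemma Mid_Mid:
  "\<forall>j<8. \<forall>k<8. j \<noteq> k \<longrightarrow>
     (hinner (x (Mid j)) (x (Mid k)) = 0 \<longleftrightarrow> H20_adjacent (Mid j) (Mid k))"
  unfolding all_less_8
  \<comment> \<open>Deleting \<open>One_nat_def\<close> keeps the index 1 in the form in which
    \<open>mu\<close> and \<open>tau\<close> are stated.\<close>
  by (simp add: hinner_Mid_Mid quad_simps H20_adjacent_simps del: One_nat_def)

lemma Corner_Mid:
  "\<forall>j<8. \<forall>k<8. hinner (x (Corner j)) (x (Mid k)) = 0 \<longleftrightarrow> H20_adjacent (Corner j) (Mid k)"
proof -
  \<comment> \<open>Every term of the determinant has one factor \<open>s\<close> and one factor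
    \<open>r\<close>; dividing by them leaves an element of the field.\<close>
  have "hinner (x (Corner j)) (x (Mid k)) =
      of_real s * of_real r *
        ((\<mu> i * \<tau> k - \<tau> i * \<mu> k) + \<mu> j * (\<tau> i - \<tau> k) + \<tau> j * (\<mu> k - \<mu> i))"
    if "j < 8" "k < 8" "i = (j + 1) mod 8" for i j k
    using that by (simp add: Corner hinner_cnj_ccross Mid vector_3 algebra_simps)
  then have "hinner (x (Corner j)) (x (Mid k)) = 0 \<longleftrightarrow>
      (\<mu> i * \<tau> k - \<tau> i * \<mu> k) + \<mu> j * (\<tau> i - \<tau> k) + \<tau> j * (\<mu> k - \<mu> i) = 0"
    if "j < 8" "k < 8" "i = (j + 1) mod 8" for i j k
    using that s_nonzero r_nonzero by simp
  note * = this[OF _ _ refl]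
  show ?thesis
    unfolding all_less_8
    by (simp add: * quad_simps H20_adjacent_simps del: One_nat_def)
qed

text \<open>Consecutive corners share a midpoint, so the reduction also uses
  \<open>hinner_Mid_Mid\<close> at equal indices.\<close>

lemma Corner_Corner:
  "\<forall>j<8. \<forall>k<8. j \<noteq> k \<longrightarrow>
     (hinner (x (Corner j)) (x (Corner k)) = 0 \<longleftrightarrow> H20_adjacent (Corner j) (Corner k))"
  unfolding all_less_8
  by (simp add: Corner hinner_cnj_ccross_cnj_ccross hinner_Mid_Mid quad_simps H20_adjacent_simps
      del: One_nat_def)

lemma Apex_Mid:
  "\<forall>a\<in>{A1, A2, B1, B2}. \<forall>j<8. hinner (x a) (x (Mid j)) = 0 \<longleftrightarrow> H20_adjacent a (Mid j)"
proof -
  have "hinner (vector [of_real s, \<alpha>, 0]) (x (Mid j)) = of_real s * (1 + cnj \<alpha> * \<mu> j)"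
    if "j < 8" for \<alpha> j
    using that by (simp add: Mid hinner_vector_3 algebra_simps)
  \<comment> \<open>For \<open>\<alpha>\<close> of modulus 1, as for all four apexes, the condition
    on the right says that \<open>\<mu> j\<close> equals \<open>- \<alpha>\<close>.\<close>
  then have *: "hinner (vector [of_real s, \<alpha>, 0]) (x (Mid j)) = 0 \<longleftrightarrow> 1 + cnj \<alpha> * \<mu> j = 0"
    if "j < 8" for \<alpha> j
    using that s_nonzero by simp
  show ?thesis
    unfolding all_less_8
    by (simp add: A1 A2 B1 B2 * quad_simps H20_adjacent_simps del: One_nat_def)
qed

lemma Corner_Apex:
  "\<forall>j<8. \<forall>a\<in>{A1, A2, B1, B2}. hinner (x (Corner j)) (x a) = 0 \<longleftrightarrow> H20_adjacent (Corner j) a"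
proof -
  \<comment> \<open>The first coordinates contribute \<open>s\<close> twice, giving
    \<open>C\<close>; the third coordinate of the apex is 0, so \<open>r\<close> is a common
    factor.\<close>
  have "hinner (x (Corner j)) (vector [of_real s, \<alpha>, 0]) =
      of_real r * (of_real C * (\<mu> j * \<tau> i - \<tau> j * \<mu> i) + \<alpha> * (\<tau> j - \<tau> i))"
    if "j < 8" "i = (j + 1) mod 8" for i j \<alpha>
    using that
    by (simp add: Corner hinner_cnj_ccross Mid vector_3 algebra_simps flip: s_squared)
  then have "hinner (x (Corner j)) (vector [of_real s, \<alpha>, 0]) = 0 \<longleftrightarrow>
      of_real C * (\<mu> j * \<tau> i - \<tau> j * \<mu> i) + \<alpha> * (\<tau> j - \<tau> i) = 0"
    if "j < 8" "i = (j + 1) mod 8" for i j \<alpha>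
    using that r_nonzero by simp
  note * = this[OF _ refl]
  show ?thesis
    unfolding all_less_8
    by (simp add: A1 A2 B1 B2 * quad_simps H20_adjacent_simps del: One_nat_def)
qed

lemma Apex_Apex:
  "\<forall>a\<in>{A1, A2, B1, B2}. \<forall>b\<in>{A1, A2, B1, B2}. a \<noteq> b \<longrightarrow>
     (hinner (x a) (x b) = 0 \<longleftrightarrow> H20_adjacent a b)"
  by (simp add: A1 A2 B1 B2 hinner_vector_3 s_squared quad_simps H20_adjacent_simps
      del: One_nat_def)

lemma hinner_eq_0_iff_adjacent:
  assumes "u \<in> H20_vertices" "v \<in> H20_vertices" "u \<noteq> v"
  shows "hinner (x u) (x v) = 0 \<longleftrightarrow> H20_adjacent u v"
proof -
  \<comment> \<open>Mixed pairs were treated in one order only; conjugation of the product gives the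
    other order.\<close>
  have sym: "hinner (x u) (x v) = 0 \<longleftrightarrow> H20_adjacent u v"
    if "hinner (x v) (x u) = 0 \<longleftrightarrow> H20_adjacent v u" for u v
    using that by (metis H20_adjacent_commute hinner_commute complex_cnj_zero)
  show ?thesis
    using assms(1)
  proof (cases rule: H20_vertex_cases)
    case (Mid j)
    from assms(2) show ?thesis
      by (cases rule: H20_vertex_cases)
        (use Mid assms(3) Mid_Mid sym Corner_Mid Apex_Mid in blast)+
  next
    case (Corner j)
    from assms(2) show ?thesis
      by (cases rule: H20_vertex_cases)
        (use Corner assms(3) Corner_Mid Corner_Corner Corner_Apex in blast)+
  next
    case Apex
    from assms(2) show ?thesis
      by (cases rule: H20_vertex_cases)
        (use Apex assms(3) Apex_Mid sym Corner_Apex Apex_Apex in blast)+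
  qed
qed

lemma Corner_coordinates:
  assumes "j < 8"
  shows "x (Corner j) = vector
            [of_real s * of_real r * (cnj (\<mu> j) * cnj (\<tau> ((j + 1) mod 8))
                                      - cnj (\<tau> j) * cnj (\<mu> ((j + 1) mod 8))),
             of_real r * (cnj (\<tau> j) - cnj (\<tau> ((j + 1) mod 8))),
             of_real s * (cnj (\<mu> ((j + 1) mod 8)) - cnj (\<mu> j))]"
  using assms
  by (simp add: Corner Mid cnj_vec_def ccross_def vec_eq_iff forall_3 vector_3 algebra_simps)

end

theorem theorem4:
  fixes C s N r :: real
    and \<eta> \<zeta> :: complex
    and \<mu> \<tau> :: "nat \<Rightarrow> complex"
    and x :: "vertex \<Rightarrow> complex ^ 3"
  assumes "C = (49 - 5 * sqrt 69) / 26"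
    and "s = sqrt C"
    and "N = 1 + C"
    and "r = sqrt N"
    and "\<eta> = (5 + 12 * \<i>) / 13"
    and "\<zeta> = complex_of_real ((14 + 6 * sqrt 69) / 65)
              + \<i> * complex_of_real ((4 * sqrt 69 - 21) / 65)"
    and "map \<mu> [0..<8] = [-1, \<eta>, 1, -\<eta>, -1, \<eta>, 1, -\<eta>]"
    and "map \<tau> [0..<8] = [1, \<zeta>, -\<i>, -\<i> * \<zeta>, -1, -\<zeta>, \<i>, \<i> * \<zeta>]"
    and "x A1 = vector [of_real s, 1, 0]"
    and "x A2 = vector [of_real s, -1, 0]"
    and "x B1 = vector [of_real s, \<eta>, 0]"
    and "x B2 = vector [of_real s, -\<eta>, 0]"
    and "\<And>j. j < 8 \<Longrightarrow> x (Mid j) = vector [1, of_real s * \<mu> j, of_real r * \<tau> j]"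
    and "\<And>j. j < 8 \<Longrightarrow> x (Corner j) = cnj_vec (ccross (x (Mid j)) (x (Mid ((j + 1) mod 8))))"
  shows "(\<forall>j<8. x (Corner j) = vector
            [of_real s * of_real r * (cnj (\<mu> j) * cnj (\<tau> ((j + 1) mod 8))
                                      - cnj (\<tau> j) * cnj (\<mu> ((j + 1) mod 8))),
             of_real r * (cnj (\<tau> j) - cnj (\<tau> ((j + 1) mod 8))),
             of_real s * (cnj (\<mu> ((j + 1) mod 8)) - cnj (\<mu> j))]) \<and>
         faithful_orthogonal_representation H20_vertices H20_edges x"
proof -
  interpret H20_vectors C s N r \<eta> \<zeta> \<mu> \<tau> x
    by unfold_locales (fact assms)+
  show ?thesis
    using Corner_coordinates
      faithful_orthogonal_representation_H20I[of x, OF _ hinner_eq_0_iff_adjacent]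
    by simp
qed

end
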